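(* Let $G$ be a compact group, $n\ge1$, and let $H$ and $N$ be closed subgroups of $G$ such that $N\le H$ and $N$ is normal in $G$. Then $d^{(n)}(H,G)\le d^{(n)}(H/N,G/N)$. Moreover, equality holds if $N\cap[{}_nH,G]$ is trivial.
   Context: For a compact group $X$, $\mu_X$ denotes its normalized Haar measure and $\mu_X^m$ the product measure on $X^m$; $G/N$, $H/N$ are compact groups with their normalized Haar measures. Commutators: $[x,y]=x^{-1}y^{-1}xy$, $[x_1]=x_1$, $[x_1,\dots,x_{k+1}]=[[x_1,\dots,x_k],x_{k+1}]$. For subgroups $A,B$, $[A,B]$ is the subgroup generated by all $[a,b]$, and $[{}_nH,G]=[[\dots[[H,H],H],\dots,H],G]$ with $n$ copies of $H$ (so $[{}_1H,G]=[H,G]$). For a closed subgroup $H$ of a compact group $L$, $d^{(n)}(H,L)=(\mu_H^n\times\mu_L)(\{(h_1,\dots,h_n,g)\in H^n\times L: [h_1,\dots,h_n,g]=1\})$. *)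

theory Defs
  imports "HOL-Probability.Probability" "HOL-Algebra.Algebra"
begin

definition compact_group :: "('a, 'b) monoid_scheme \<Rightarrow> 'a topology \<Rightarrow> bool" where
  "compact_group G T \<longleftrightarrow> group G \<and> topspace T = carrier G \<and> compact_space T \<and> Hausdorff_space T \<and>
     continuous_map (prod_topology T T) T (\<lambda>(x, y). x \<otimes>\<^bsub>G\<^esub> y) \<and>
     continuous_map T T (\<lambda>x. inv\<^bsub>G\<^esub> x)"

definition quot_top :: "'a topology \<Rightarrow> 'a set set \<Rightarrow> 'a set topology" where
  "quot_top T P = topology (\<lambda>U. U \<subseteq> P \<and> openin T (\<Union>U))"

definition borel_of :: "'a topology \<Rightarrow> 'a measure" where
  "borel_of T = sigma (topspace T) {U. openin T U}"

text \<open>Radon probability measure on the Borel sets of T (for finite measures: inner regular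
  by compact sets on all Borel sets).\<close>
definition radon_prob :: "'a topology \<Rightarrow> 'a measure \<Rightarrow> bool" where
  "radon_prob T \<mu> \<longleftrightarrow> prob_space \<mu> \<and> space \<mu> = topspace T \<and> sets \<mu> = sets (borel_of T) \<and>
     (\<forall>A\<in>sets \<mu>. measure \<mu> A = (SUP K\<in>{K. compactin T K \<and> K \<subseteq> A}. measure \<mu> K))"

definition haar_measure :: "('a, 'b) monoid_scheme \<Rightarrow> 'a topology \<Rightarrow> 'a measure \<Rightarrow> bool" where
  "haar_measure K TK \<mu> \<longleftrightarrow> radon_prob TK \<mu> \<and>
     (\<forall>g\<in>carrier K. \<forall>A\<in>sets \<mu>. measure \<mu> ((\<lambda>x. g \<otimes>\<^bsub>K\<^esub> x) ` A) = measure \<mu> A)"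

text \<open>\<nu> is the (Radon) product measure \<mu>_K^n \<times> \<mu>_L on K^n \<times> L, where \<mu>_K, \<mu>_L are the
  normalized Haar measures of the compact groups (K,TK), (L,TL).  Points of K^n are
  extensional functions on {..<n}.\<close>
definition haar_prod :: "('a, 'b) monoid_scheme \<Rightarrow> 'a topology \<Rightarrow> ('a, 'c) monoid_scheme \<Rightarrow> 'a topology
     \<Rightarrow> nat \<Rightarrow> ((nat \<Rightarrow> 'a) \<times> 'a) measure \<Rightarrow> bool" where
  "haar_prod L TL K TK n \<nu> \<longleftrightarrow>
     (\<exists>\<mu>K \<mu>L. haar_measure K TK \<mu>K \<and> haar_measure L TL \<mu>L \<and>
        radon_prob (prod_topology (product_topology (\<lambda>_. TK) {..<n}) TL) \<nu> \<and>
        (\<forall>A B. (\<forall>i<n. A i \<in> sets \<mu>K) \<longrightarrow> B \<in> sets \<mu>L \<longrightarrow>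
            measure \<nu> (PiE {..<n} A \<times> B) = (\<Prod>i<n. measure \<mu>K (A i)) * measure \<mu>L B))"

definition comm :: "('a, 'b) monoid_scheme \<Rightarrow> 'a \<Rightarrow> 'a \<Rightarrow> 'a" where
  "comm G x y = inv\<^bsub>G\<^esub> x \<otimes>\<^bsub>G\<^esub> inv\<^bsub>G\<^esub> y \<otimes>\<^bsub>G\<^esub> x \<otimes>\<^bsub>G\<^esub> y"

text \<open>lcomm G h k = [h 0, h 1, ..., h (k-1)] (left-normed), for k \<ge> 1.\<close>
fun lcomm :: "('a, 'b) monoid_scheme \<Rightarrow> (nat \<Rightarrow> 'a) \<Rightarrow> nat \<Rightarrow> 'a" where
  "lcomm G h 0 = \<one>\<^bsub>G\<^esub>"
| "lcomm G h (Suc 0) = h 0"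
| "lcomm G h (Suc (Suc k)) = comm G (lcomm G h (Suc k)) (h (Suc k))"

text \<open>d^(n)(K, L) computed w.r.t. the product measure \<nu> on K^n \<times> L, commutators taken in G.\<close>
definition dn :: "('a, 'b) monoid_scheme \<Rightarrow> nat \<Rightarrow> ((nat \<Rightarrow> 'a) \<times> 'a) measure \<Rightarrow> real" where
  "dn G n \<nu> = measure \<nu> {(h, g) \<in> space \<nu>. comm G (lcomm G h n) g = \<one>\<^bsub>G\<^esub>}"

definition comm_subgroup :: "('a, 'b) monoid_scheme \<Rightarrow> 'a set \<Rightarrow> 'a set \<Rightarrow> 'a set" where
  "comm_subgroup G A B = generate G {comm G a b | a b. a \<in> A \<and> b \<in> B}"

fun lower_iter :: "('a, 'b) monoid_scheme \<Rightarrow> 'a set \<Rightarrow> nat \<Rightarrow> 'a set" where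
  "lower_iter G H 0 = H"
| "lower_iter G H (Suc 0) = H"
| "lower_iter G H (Suc (Suc k)) = comm_subgroup G (lower_iter G H (Suc k)) H"

text \<open>[_n H, G] = [[...[[H,H],H],...,H],G] with n copies of H.\<close>
definition nHG :: "('a, 'b) monoid_scheme \<Rightarrow> nat \<Rightarrow> 'a set \<Rightarrow> 'a set" where
  "nHG G n H = comm_subgroup G (lower_iter G H n) (carrier G)"

end

theory Submission
  imports Defs
begin

text \<open>The image of the product Haar measure on \<open>H\<^sup>n \<times> G\<close> under the quotient map
  \<open>q : H\<^sup>n \<times> G \<rightarrow> (H/N)\<^sup>n \<times> G/N\<close> is the product Haar measure there: its
  marginals are left invariant, hence Haar by uniqueness, and a Radon measure on a finite product
  of Hausdorff spaces is determined by its values on open rectangles.  Consequently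
  \<open>d\<^sup>(\<^sup>n\<^sup>)(H/N, G/N)\<close> is the measure of the set of tuples whose commutator
  lies in \<open>N\<close>.  This set contains the tuples with trivial commutator, and coincides with them
  if \<open>N\<close> meets \<open>[\<^sub>nH, G]\<close> trivially.\<close>

section \<open>Radon probability measures\<close>

text \<open>The groups need not be second countable, and this shapes the whole argument: the Borel
  \<sigma>-algebra of a product may be strictly larger than the product \<sigma>-algebra. A product
  Haar measure is therefore a Radon measure on the Borel sets of the product topology, prescribed
  only on rectangles, and agreement on a generating \<pi>-system does not by itself decide the
  remaining Borel sets. Regularity closes the gap: by \<open>radon_eqI\<close> it is enough to
  compare a compact \<open>K\<close> with an open \<open>U\<close> containing it. The room between
  \<open>K\<close> and \<open>U\<close> admits an auxiliary object that is measurable in the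
  elementary sense: a step function for the uniqueness of Haar measure, a finite union of open
  rectangles for products.\<close>

lemma space_borel_of [simp]: "space (borel_of T) = topspace T"
  unfolding borel_of_def by (rule space_measure_of) (auto dest: openin_subset)

lemma openin_borel_of: "openin T U \<Longrightarrow> U \<in> sets (borel_of T)"
  unfolding borel_of_def by (subst sets_measure_of) (auto dest: openin_subset)

lemma closedin_borel_of:
  assumes "closedin T C" shows "C \<in> sets (borel_of T)"
proof -
  have "topspace T - C \<in> sets (borel_of T)"
    using assms by (intro openin_borel_of) auto
  then have "space (borel_of T) - (topspace T - C) \<in> sets (borel_of T)"
    by (rule sets.compl_sets)
  moreover have "space (borel_of T) - (topspace T - C) = C"
    using closedin_subset[OF assms] by auto
  ultimately show ?thesis by simp
qed

lemma measurable_borel_of: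
  assumes "continuous_map S T f"
  shows "f \<in> measurable (borel_of S) (borel_of T)"
  unfolding borel_of_def[of T]
proof (rule measurable_measure_of)
  show "f \<in> space (borel_of S) \<rightarrow> topspace T"
    using continuous_map_funspace[OF assms] by simp
  fix U assume "U \<in> {U. openin T U}"
  then have "openin S {x \<in> topspace S. f x \<in> U}"
    using assms openin_continuous_map_preimage by blast
  moreover have "f -` U \<inter> space (borel_of S) = {x \<in> topspace S. f x \<in> U}" by auto
  ultimately show "f -` U \<inter> space (borel_of S) \<in> sets (borel_of S)"
    by (simp add: openin_borel_of)
qed (auto dest: openin_subset)

lemma
  assumes "radon_prob T \<mu>"
  shows radon_prob_space: "prob_space \<mu>"
    and space_radon: "space \<mu> = topspace T"
    and sets_radon: "sets \<mu> = sets (borel_of T)"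
  using assms unfolding radon_prob_def by auto

lemma radon_inner:
  assumes "radon_prob T \<mu>" "A \<in> sets \<mu>" "e > 0"
  obtains K where "compactin T K" "K \<subseteq> A" "measure \<mu> A < measure \<mu> K + e"
proof -
  let ?S = "(\<lambda>K. measure \<mu> K) ` {K. compactin T K \<and> K \<subseteq> A}"
  have "measure \<mu> A = Sup ?S"
    using assms unfolding radon_prob_def by auto
  moreover have "?S \<noteq> {}" by (auto intro!: exI[of _ "{}"])
  moreover have "Sup ?S - e < Sup ?S" using assms by simp
  ultimately obtain s where "s \<in> ?S" "measure \<mu> A - e < s"
    using less_cSupD[of ?S "measure \<mu> A - e"] by auto
  then show thesis using that by auto
qed

text \<open>Outer approximation is inner approximation of the complement: a compact subset of
  \<open>space \<mu> - A\<close> is closed because \<open>T\<close> is Hausdorff, and its complement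
  is the open set wanted.\<close>

lemma radon_outer:
  assumes "radon_prob T \<mu>" "Hausdorff_space T" "A \<in> sets \<mu>" "e > 0"
  obtains U where "openin T U" "A \<subseteq> U" "measure \<mu> U < measure \<mu> A + e"
proof -
  interpret prob_space \<mu> by (rule radon_prob_space[OF assms(1)])
  obtain K where K: "compactin T K" "K \<subseteq> space \<mu> - A" "measure \<mu> (space \<mu> - A) < measure \<mu> K + e"
    using radon_inner[OF assms(1), of "space \<mu> - A"] assms by blast
  have "closedin T K" using K assms compactin_imp_closedin by blast
  then have "K \<in> sets \<mu>" using assms(1) by (simp add: closedin_borel_of sets_radon)
  then have "measure \<mu> (space \<mu> - K) < measure \<mu> A + e"
    using K assms by (simp add: prob_compl)
  moreover have "A \<subseteq> space \<mu> - K" using K sets.sets_into_space[OF assms(3)] by auto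
  moreover have "openin T (space \<mu> - K)"
    using \<open>closedin T K\<close> assms(1) by (simp add: space_radon openin_diff)
  ultimately show thesis using that by blast
qed

text \<open>Inner regularity of \<open>\<mu>\<close> and outer regularity of \<open>\<nu>\<close>
  extend the inequality from pairs \<open>K\<close>, \<open>U\<close> to every Borel set. Applied
  also to the complement, where total mass 1 reverses it, it becomes an equality; this is why a
  one-sided comparison suffices.\<close>

lemma radon_eqI:
  assumes \<mu>: "radon_prob T \<mu>" and \<nu>: "radon_prob T \<nu>" and T: "Hausdorff_space T"
    and le: "\<And>K U. compactin T K \<Longrightarrow> openin T U \<Longrightarrow> K \<subseteq> U \<Longrightarrow> measure \<mu> K \<le> measure \<nu> U"
  shows "\<mu> = \<nu>"
proof -
  interpret \<mu>: prob_space \<mu> by (rule radon_prob_space[OF \<mu>])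
  interpret \<nu>: prob_space \<nu> by (rule radon_prob_space[OF \<nu>])
  have sets: "sets \<mu> = sets \<nu>" and space: "space \<mu> = space \<nu>"
    using \<mu> \<nu> by (simp_all add: sets_radon space_radon)
  have mono: "measure \<mu> A \<le> measure \<nu> A" if A: "A \<in> sets \<mu>" for A
  proof (rule field_le_epsilon)
    fix e :: real assume "e > 0"
    obtain K where K: "compactin T K" "K \<subseteq> A" "measure \<mu> A < measure \<mu> K + e/2"
      using radon_inner[OF \<mu> A, of "e/2"] \<open>e > 0\<close> by auto
    obtain U where U: "openin T U" "A \<subseteq> U" "measure \<nu> U < measure \<nu> A + e/2"
      using radon_outer[OF \<nu> T, of A "e/2"] A \<open>e > 0\<close> sets by auto
    show "measure \<mu> A \<le> measure \<nu> A + e"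
      using le[of K U] K U by force
  qed
  have "measure \<mu> A = measure \<nu> A" if A: "A \<in> sets \<mu>" for A
    using mono[OF A] mono[of "space \<mu> - A"] A \<mu>.prob_compl[of A] \<nu>.prob_compl[of A] sets space
    by simp
  then show ?thesis
    using sets by (intro measure_eqI) (auto simp: \<mu>.emeasure_eq_measure \<nu>.emeasure_eq_measure)
qed

text \<open>Continuous maps carry compact sets to compact sets: if \<open>K\<close> nearly exhausts
  the preimage of \<open>A\<close>, then its image is a compact subset of \<open>A\<close> with at
  least the mass of \<open>K\<close>. Hausdorffness of \<open>T\<close> makes that image closed,
  hence Borel.\<close>

lemma radon_distr:
  assumes \<mu>: "radon_prob S \<mu>" and f: "continuous_map S T f" and T: "Hausdorff_space T"
  shows "radon_prob T (distr \<mu> (borel_of T) f)"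
proof -
  interpret prob_space \<mu> by (rule radon_prob_space[OF \<mu>])
  have meas [measurable]: "f \<in> measurable \<mu> (borel_of T)"
    using measurable_borel_of[OF f] measurable_cong_sets[OF sets_radon[OF \<mu>] refl] by blast
  interpret D: prob_space "distr \<mu> (borel_of T) f" by (rule prob_space_distr) (rule meas)
  have comp: "K \<in> sets (borel_of T)" if "compactin T K" for K
    using that T closedin_borel_of compactin_imp_closedin by blast
  show ?thesis
    unfolding radon_prob_def
  proof (intro conjI ballI)
    fix A assume "A \<in> sets (distr \<mu> (borel_of T) f)"
    then have A: "A \<in> sets (borel_of T)" by simp
    let ?D = "distr \<mu> (borel_of T) f"
    let ?S = "(\<lambda>K. measure ?D K) ` {K. compactin T K \<and> K \<subseteq> A}"
    have "measure ?D A \<le> Sup ?S"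
    proof (rule field_le_epsilon)
      fix e :: real assume "e > 0"
      have "f -` A \<inter> space \<mu> \<in> sets \<mu>" using A meas by (rule measurable_sets[rotated])
      then obtain K where K: "compactin S K" "K \<subseteq> f -` A \<inter> space \<mu>"
          "measure \<mu> (f -` A \<inter> space \<mu>) < measure \<mu> K + e"
        using radon_inner[OF \<mu>] \<open>e > 0\<close> by metis
      have fK: "compactin T (f ` K)" using K f image_compactin by blast
      have "measure \<mu> K \<le> measure \<mu> (f -` (f ` K) \<inter> space \<mu>)"
        using K comp[OF fK] by (intro finite_measure_mono measurable_sets[OF meas]) auto
      also have "\<dots> = measure ?D (f ` K)"
        using comp[OF fK] by (simp add: measure_distr)
      also have "\<dots> \<le> Sup ?S"
        using fK K by (intro cSup_upper bdd_aboveI[of _ 1]) auto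
      finally show "measure ?D A \<le> Sup ?S + e"
        using K A by (simp add: measure_distr)
    qed
    moreover have "Sup ?S \<le> measure ?D A"
      using A by (intro cSup_least) (auto intro!: exI[of _ "{}"] D.finite_measure_mono)
    ultimately show "measure ?D A = Sup ?S" by simp
  qed (auto intro: D.prob_space_axioms)
qed

section \<open>Compact groups\<close>

lemma
  assumes "compact_group G T"
  shows compact_group_group: "group G"
    and topspace_compact_group: "topspace T = carrier G"
    and compact_space_compact_group: "compact_space T"
    and Hausdorff_compact_group: "Hausdorff_space T"
    and compact_group_mult: "continuous_map (prod_topology T T) T (\<lambda>(x, y). x \<otimes>\<^bsub>G\<^esub> y)"
    and compact_group_inv: "continuous_map T T (\<lambda>x. inv\<^bsub>G\<^esub> x)"
  using assms unfolding compact_group_def by auto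

lemma continuous_map_mult:
  assumes "compact_group G T" "continuous_map Z T f" "continuous_map Z T g"
  shows "continuous_map Z T (\<lambda>x. f x \<otimes>\<^bsub>G\<^esub> g x)"
proof -
  have "continuous_map Z (prod_topology T T) (\<lambda>x. (f x, g x))"
    using assms by (simp add: continuous_map_pairedI)
  from continuous_map_compose[OF this compact_group_mult[OF assms(1)]] show ?thesis
    by (simp add: o_def)
qed

lemma continuous_map_inv:
  assumes "compact_group G T" "continuous_map Z T f"
  shows "continuous_map Z T (\<lambda>x. inv\<^bsub>G\<^esub> (f x))"
  using continuous_map_compose[OF assms(2) compact_group_inv[OF assms(1)]] by (simp add: o_def)

lemma continuous_map_comm:
  assumes "compact_group G T" "continuous_map Z T f" "continuous_map Z T g"
  shows "continuous_map Z T (\<lambda>x. comm G (f x) (g x))"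
  unfolding comm_def using assms by (intro continuous_map_mult continuous_map_inv)

lemma continuous_map_lcomm:
  assumes G: "compact_group G T" and "\<And>i. i < k \<Longrightarrow> continuous_map Z T (\<lambda>x. f x i)"
  shows "continuous_map Z T (\<lambda>x. lcomm G (f x) k)"
  using assms(2)
proof (induction k rule: induct_nat_012)
  case 0
  interpret group G by (rule compact_group_group[OF G])
  show ?case using topspace_compact_group[OF G] by simp
next
  case (ge2 k)
  then show ?case by (simp add: continuous_map_comm[OF G])
qed simp

lemma compact_group_subgroup:
  fixes G (structure)
  assumes G: "compact_group G T" and H: "subgroup H G" and cl: "closedin T H"
  shows "compact_group (G\<lparr>carrier := H\<rparr>) (subtopology T H)"
proof -
  interpret group G by (rule compact_group_group[OF G])
  let ?H = "subtopology T H"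
  have top: "topspace ?H = H"
    using closedin_subset[OF cl] by auto
  have incl: "continuous_map ?H T (\<lambda>x. x)"
    by (simp add: continuous_map_from_subtopology)
  have "continuous_map (prod_topology ?H ?H) T (\<lambda>x. fst x \<otimes> snd x)"
    using continuous_map_compose[OF continuous_map_fst incl] continuous_map_compose[OF continuous_map_snd incl]
    by (intro continuous_map_mult[OF G]) (simp_all add: o_def)
  moreover have "(\<lambda>x. fst x \<otimes> snd x) \<in> topspace (prod_topology ?H ?H) \<rightarrow> H"
    using subgroup.m_closed[OF H] unfolding topspace_prod_topology top by auto
  ultimately have mult: "continuous_map (prod_topology ?H ?H) ?H (\<lambda>(x, y). x \<otimes> y)"
    unfolding continuous_map_in_subtopology case_prod_unfold by blast
  have "(\<lambda>x. inv x) \<in> topspace ?H \<rightarrow> H"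
    using subgroup.m_inv_closed[OF H] unfolding top by auto
  then have "continuous_map ?H ?H (\<lambda>x. inv x)"
    using continuous_map_inv[OF G incl] by (simp only: continuous_map_in_subtopology)
  then have inv: "continuous_map ?H ?H (\<lambda>x. inv\<^bsub>G\<lparr>carrier := H\<rparr>\<^esub> x)"
    by (rule continuous_map_eq) (simp add: top H)
  show ?thesis
    unfolding compact_group_def
    using top mult inv subgroup_imp_group[OF H]
      compact_space_subtopology[OF closedin_compact_space[OF compact_space_compact_group[OF G] cl]]
      Hausdorff_space_subtopology[OF Hausdorff_compact_group[OF G]]
    by simp
qed

section \<open>Quotients of compact groups\<close>

text \<open>\<open>topology\<close> returns the intended open sets only for a family known to be a
  topology. Disjointness is what gives closure under intersection: a point of both
  \<open>\<Union>U\<close> and \<open>\<Union>V\<close> lies in a single member of \<open>P\<close>,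
  which then belongs to \<open>U\<close> and to \<open>V\<close>.\<close>

lemma openin_quot_top:
  assumes "pairwise disjnt P"
  shows "openin (quot_top T P) U \<longleftrightarrow> U \<subseteq> P \<and> openin T (\<Union>U)"
proof -
  have eq: "A = B" if "A \<in> P" "B \<in> P" "x \<in> A" "x \<in> B" for A B x
    using that assms unfolding pairwise_def disjnt_def by blast
  have Int: "\<Union>(U \<inter> V) = \<Union>U \<inter> \<Union>V" if "U \<subseteq> P" "V \<subseteq> P" for U V
  proof
    show "\<Union>U \<inter> \<Union>V \<subseteq> \<Union>(U \<inter> V)"
    proof
      fix x assume "x \<in> \<Union>U \<inter> \<Union>V"
      then obtain A B where "A \<in> U" "B \<in> V" "x \<in> A" "x \<in> B" by blast
      then show "x \<in> \<Union>(U \<inter> V)" using eq[of A B x] that by blast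
    qed
  qed blast
  have "istopology (\<lambda>U. U \<subseteq> P \<and> openin T (\<Union>U))"
    unfolding istopology_def
  proof (intro conjI allI impI)
    fix \<K> assume "\<forall>U\<in>\<K>. U \<subseteq> P \<and> openin T (\<Union>U)"
    then have "openin T (\<Union>U\<in>\<K>. \<Union>U)" by blast
    moreover have "(\<Union>U\<in>\<K>. \<Union>U) = \<Union>(\<Union>\<K>)" by blast
    ultimately show "openin T (\<Union>(\<Union>\<K>))" by simp
  qed (auto simp: Int openin_Int)
  then show ?thesis
    unfolding quot_top_def by (simp add: topology_inverse')
qed

text \<open>A coset that meets \<open>\<Union>U\<close> belongs to \<open>U\<close>, so the preimage
  of a family \<open>U\<close> of cosets is \<open>\<Union>U\<close>. The openness condition of
  \<open>quot_top\<close> is thus exactly that of the quotient topology.\<close>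

lemma quotient_map_cosets:
  fixes G (structure)
  assumes G: "compact_group G T" and N: "N \<lhd> G"
  shows "quotient_map T (quot_top T (rcosets\<^bsub>G\<^esub> N)) (\<lambda>x. N #>\<^bsub>G\<^esub> x)"
proof -
  interpret normal N G by fact
  let ?P = "rcosets N" and ?q = "\<lambda>x. N #> x"
  have top: "topspace T = carrier G" by (rule topspace_compact_group[OF G])
  have disj: "pairwise disjnt ?P" by (rule rcos_disjoint) (rule is_subgroup)
  have un: "\<Union>?P = carrier G" by (rule rcosets_part_G) (rule is_subgroup)
  have "openin (quot_top T ?P) ?P" 
    unfolding openin_quot_top[OF disj] un top[symmetric] by simp
  then have topq: "topspace (quot_top T ?P) = ?P"
    by (metis openin_quot_top[OF disj] openin_subset openin_topspace subset_antisym)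
  have pre: "{x \<in> carrier G. ?q x \<in> U} = \<Union>U" if "U \<subseteq> ?P" for U
  proof -
    have "x \<in> \<Union>U \<longleftrightarrow> x \<in> carrier G \<and> ?q x \<in> U" for x
    proof
      assume "x \<in> \<Union>U"
      then obtain A where A: "A \<in> U" "x \<in> A" by auto
      then obtain a where "a \<in> carrier G" "A = ?q a" using \<open>U \<subseteq> ?P\<close> by (auto simp: RCOSETS_def)
      then show "x \<in> carrier G \<and> ?q x \<in> U"
        using A is_subgroup by (metis repr_independence r_coset_subset_G subset subsetD)
    next
      assume "x \<in> carrier G \<and> ?q x \<in> U"
      then show "x \<in> \<Union>U" using rcos_self[OF _ is_subgroup] by blast
    qed
    then show ?thesis by auto
  qed
  show ?thesis
    unfolding quotient_map_def topq top openin_quot_top[OF disj]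
  proof (intro conjI allI impI)
    show "?q ` carrier G = ?P" by (auto simp: RCOSETS_def)
  qed (simp add: pre)
qed

text \<open>The Hausdorff property is the delicate point. The saturation of a closed set
  \<open>C\<close> is the product set \<open>N C\<close>, an image of the compact set
  \<open>N \<times> C\<close>, hence closed. So the coset map is closed, and a closed continuous
  image of a normal Hausdorff space is Hausdorff.\<close>

lemma compact_group_Mod:
  fixes G (structure)
  assumes G: "compact_group G T" and N: "N \<lhd> G" and cl: "closedin T N"
  shows "compact_group (G Mod N) (quot_top T (rcosets\<^bsub>G\<^esub> N))"
proof -
  interpret normal N G by fact
  let ?Q = "quot_top T (rcosets N)" and ?q = "\<lambda>x. N #> x"
  have top: "topspace T = carrier G" by (rule topspace_compact_group[OF G])
  note T = compact_space_compact_group[OF G] Hausdorff_compact_group[OF G]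
  have q: "quotient_map T ?Q ?q" using G N by (rule quotient_map_cosets)
  then have qc: "continuous_map T ?Q ?q" by (rule quotient_imp_continuous_map)
  have surj: "?q ` carrier G = topspace ?Q" using quotient_imp_surjective_map[OF q] top by simp
  then have topq: "topspace ?Q = carrier (G Mod N)" by (auto simp: FactGroup_def RCOSETS_def)
  have compQ: "compact_space ?Q"
    using T(1) image_compactin[OF _ qc] quotient_imp_surjective_map[OF q]
    by (metis compact_space_def)
  have "closed_map T ?Q ?q"
    unfolding closed_map_def
  proof (intro allI impI)
    fix C assume C: "closedin T C"
    then have sub: "C \<subseteq> carrier G" using closedin_subset top by auto
    have "compactin (prod_topology T T) (N \<times> C)"
      using C cl T by (simp add: compactin_Times closedin_compact_space)
    then have "compactin T ((\<lambda>(x, y). x \<otimes> y) ` (N \<times> C))"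
      using compact_group_mult[OF G] image_compactin by blast
    then have "closedin T ((\<lambda>(x, y). x \<otimes> y) ` (N \<times> C))"
      using T compactin_imp_closedin by blast
    moreover have "{x \<in> topspace T. ?q x \<in> ?q ` C} = (\<lambda>(x, y). x \<otimes> y) ` (N \<times> C)"
    proof (intro equalityI subsetI)
      fix x assume "x \<in> {x \<in> topspace T. ?q x \<in> ?q ` C}"
      then obtain c where c: "c \<in> C" "x \<in> ?q c"
        using rcos_self[OF _ is_subgroup] top by fastforce
      then obtain m where "m \<in> N" "x = m \<otimes> c" by (auto simp: r_coset_def)
      with c show "x \<in> (\<lambda>(x, y). x \<otimes> y) ` (N \<times> C)" by blast
    next
      fix x assume "x \<in> (\<lambda>(x, y). x \<otimes> y) ` (N \<times> C)"
      then obtain m c where mc: "m \<in> N" "c \<in> C" "x = m \<otimes> c" by auto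
      then have "c \<in> carrier G" "m \<in> carrier G" using sub subset by auto
      moreover from this have "?q (m \<otimes> c) = ?q c"
        using mc coset_mult_assoc[of N m c] coset_join2[of m N] is_subgroup subset by simp
      ultimately show "x \<in> {x \<in> topspace T. ?q x \<in> ?q ` C}"
        using mc top by auto
    qed
    moreover have "?q ` C \<subseteq> topspace ?Q" using sub surj by blast
    ultimately show "closedin ?Q (?q ` C)"
      using q[unfolded quotient_map_closedin, THEN conjunct2, rule_format, of "?q ` C"] by simp
  qed
  moreover have "normal_space T"
    using T by (simp add: compact_Hausdorff_or_regular_imp_normal_space)
  ultimately have HQ: "Hausdorff_space ?Q"
    using normal_Hausdorff_space_closed_continuous_map_image[OF _ T(2) _ qc] surj top by simp
  have lc: "locally_compact_space T" "locally_compact_space ?Q"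
    using T compQ by (auto intro: compact_imp_locally_compact_space)
  \<comment> \<open>A product of two quotient maps need not be a quotient map. Passing to the
    quotient in one coordinate at a time keeps the other coordinate fixed in a locally compact
    Hausdorff space, \<open>T\<close> and then \<open>?Q\<close>, where the property does hold.
    Multiplication can then be descended along the composite.\<close>
  have "quotient_map (prod_topology T T) (prod_topology ?Q ?Q) ((\<lambda>(x, y). (x, ?q y)) \<circ> (\<lambda>(x, y). (?q x, y)))"
    using T(2) HQ
    by (intro quotient_map_compose[OF quotient_map_prod_left quotient_map_prod_right] lc q) simp_all
  moreover have "continuous_map (prod_topology T T) ?Q
      ((\<lambda>(A, B). A <#> B) \<circ> ((\<lambda>(x, y). (x, ?q y)) \<circ> (\<lambda>(x, y). (?q x, y))))"
    by (rule continuous_map_eq[OF continuous_map_compose[OF compact_group_mult[OF G] qc]])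
      (auto simp: rcos_sum top)
  ultimately have mult: "continuous_map (prod_topology ?Q ?Q) ?Q (\<lambda>(A, B). A <#> B)"
    by (rule continuous_compose_quotient_map)
  have "continuous_map T ?Q ((\<lambda>A. inv\<^bsub>G Mod N\<^esub> A) \<circ> ?q)"
  proof (rule continuous_map_eq[OF continuous_map_compose[OF compact_group_inv[OF G] qc]])
    fix x assume "x \<in> topspace T"
    then show "(?q \<circ> m_inv G) x = ((\<lambda>A. inv\<^bsub>G Mod N\<^esub> A) \<circ> ?q) x"
      using top by (simp add: inv_FactGroup carrier_FactGroup rcos_inv)
  qed
  with q have "continuous_map ?Q ?Q (\<lambda>A. inv\<^bsub>G Mod N\<^esub> A)"
    by (rule continuous_compose_quotient_map)
  then show ?thesis
    unfolding compact_group_def using topq compQ HQ mult factorgroup_is_group by simp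
qed

section \<open>Uniqueness of Haar measure\<close>

text \<open>Formally \<open>\<mu> K = \<integral>\<integral> 1\<^sub>K(yx) d\<mu>(x) d\<nu>(y) = \<nu> K\<close>, but without second countability
  \<open>1\<^sub>K(yx)\<close> need not be measurable for the product \<open>\<sigma>\<close>-algebra.  Instead of applying
  Fubini's theorem, the integrand is dominated by a finite sum of products of indicators, equal
  to \<open>1\<^sub>U(yx\<^sub>i)\<close> for \<open>x\<close> in the \<open>i\<close>-th piece of a partition into small sets near \<open>x\<^sub>i\<close>.\<close>

lemma left_invariant_eq_right_invariant:
  fixes G (structure)
  assumes G: "compact_group G T" and \<mu>: "radon_prob T \<mu>" and \<nu>: "radon_prob T \<nu>"
    and left: "\<And>g A. g \<in> carrier G \<Longrightarrow> A \<in> sets (borel_of T) \<Longrightarrow>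
      measure \<mu> {x \<in> carrier G. g \<otimes> x \<in> A} = measure \<mu> A"
    and right: "\<And>g A. g \<in> carrier G \<Longrightarrow> A \<in> sets (borel_of T) \<Longrightarrow>
      measure \<nu> {x \<in> carrier G. x \<otimes> g \<in> A} = measure \<nu> A"
  shows "\<mu> = \<nu>"
proof (rule radon_eqI[OF \<mu> \<nu> Hausdorff_compact_group[OF G]])
  interpret group G by (rule compact_group_group[OF G])
  interpret \<mu>: prob_space \<mu> by (rule radon_prob_space[OF \<mu>])
  interpret \<nu>: prob_space \<nu> by (rule radon_prob_space[OF \<nu>])
  have top: "topspace T = carrier G" by (rule topspace_compact_group[OF G])
  note sets = sets_radon[OF \<mu>] sets_radon[OF \<nu>] and space = space_radon[OF \<mu>] space_radon[OF \<nu>]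
  fix K U assume K: "compactin T K" and U: "openin T U" and KU: "K \<subseteq> U"
  have KG: "K \<subseteq> carrier G" using compactin_subset_topspace[OF K] top by simp
  have K': "K \<in> sets (borel_of T)"
    using compactin_imp_closedin[OF Hausdorff_compact_group[OF G] K] by (rule closedin_borel_of)
  \<comment> \<open>The tube lemma applied to this open set yields a neighbourhood \<open>V\<close>
    of \<open>\<one>\<close> such that \<open>x \<otimes> inv v\<close> stays in \<open>U\<close>
    for all \<open>x\<close> in \<open>K\<close> and \<open>v\<close> in \<open>V\<close>.\<close>
  let ?W = "{z \<in> topspace (prod_topology T T). fst z \<otimes> inv (snd z) \<in> U}"
  have "continuous_map (prod_topology T T) T (\<lambda>z. fst z \<otimes> inv (snd z))"
    by (intro continuous_map_mult[OF G] continuous_map_inv[OF G] continuous_map_fst continuous_map_snd)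
  then have "openin (prod_topology T T) ?W"
    using U by (rule openin_continuous_map_preimage)
  moreover have "K \<times> {\<one>} \<subseteq> ?W"
  proof clarsimp
    fix x assume "x \<in> K"
    then have "x \<in> carrier G" "x \<in> U" using KG KU by auto
    then show "x \<in> topspace T \<and> \<one> \<in> topspace T \<and> x \<otimes> \<one> \<in> U" using top by simp
  qed
  ultimately obtain V where V: "openin T V" "\<one> \<in> V" and KV: "K \<times> V \<subseteq> ?W"
    using tube_lemma_left[OF _ K, of T ?W \<one>] top by fastforce
  \<comment> \<open>This is the translate \<open>x V\<close>, written as a preimage so that its
    openness follows from continuity.\<close>
  define nb where "nb x = {z \<in> topspace T. inv x \<otimes> z \<in> V}" for x
  have nb: "openin T (nb x)" if "x \<in> carrier G" for x
    unfolding nb_def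
    by (rule openin_continuous_map_preimage[OF _ V(1)])
      (intro continuous_map_mult[OF G], use that top in auto)
  have "x \<in> nb x" if "x \<in> carrier G" for x
    using that V top by (simp add: nb_def)
  then have cover: "topspace T \<subseteq> \<Union>(nb ` carrier G)" using top by blast
  have "openin T W" if "W \<in> nb ` carrier G" for W using that nb by blast
  from compactinD[OF compact_space_compact_group[OF G, unfolded compact_space_def] this cover]
  obtain \<F> where \<F>: "finite \<F>" "\<F> \<subseteq> nb ` carrier G" "topspace T \<subseteq> \<Union>\<F>" by blast
  from finite_subset_image[OF \<F>(1,2)]
  obtain D where "D \<subseteq> carrier G" "finite D" "\<F> = nb ` D" by blast
  with \<F>(3) top have D: "finite D" "D \<subseteq> carrier G" "carrier G \<subseteq> \<Union>(nb ` D)" by simp_all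
  obtain m :: nat and f where f: "D = f ` {i. i < m}"
    using finite_imp_nat_seg_image_inj_on[OF D(1)] by blast
  have fG: "f i \<in> carrier G" if "i < m" for i using f D that by auto
  \<comment> \<open>\<open>disjointed\<close> works on sequences over all naturals, so the finite
    cover is padded with empty sets; the pieces beyond \<open>m\<close> are then empty too.\<close>
  define A where "A i = (if i < m then nb (f i) else {})" for i
  define P where "P = disjointed A"
  have Asets: "range A \<subseteq> sets (borel_of T)"
    unfolding A_def using nb fG by (auto intro: openin_borel_of)
  then have Psets: "P i \<in> sets \<mu>" for i
    using sets.range_disjointed_sets[OF Asets] unfolding P_def sets by blast
  have PA: "P i \<subseteq> A i" for i unfolding P_def by (rule disjointed_subset)
  have disjP: "disjoint_family P" unfolding P_def by (rule disjoint_family_disjointed)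
  have UP: "carrier G \<subseteq> (\<Union>i<m. P i)"
  proof
    fix x assume "x \<in> carrier G"
    then obtain j where "j < m" "x \<in> nb (f j)" using D(3) f by blast
    then have "x \<in> A j" by (simp add: A_def)
    then have "x \<in> (\<Union>i. P i)" unfolding P_def UN_disjointed_eq by blast
    then obtain i where "x \<in> P i" by blast
    moreover from this have "i < m" using PA[of i] by (cases "i < m") (auto simp: A_def)
    ultimately show "x \<in> (\<Union>i<m. P i)" by blast
  qed
  define U' where "U' i = {y \<in> carrier G. y \<otimes> f i \<in> U}" for i
  have U': "U' i \<in> sets \<nu>" "measure \<nu> (U' i) = measure \<nu> U" if "i < m" for i
  proof -
    have "continuous_map T T (\<lambda>y. y \<otimes> f i)"
      using fG[OF that] top by (intro continuous_map_mult[OF G]) auto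
    then show "U' i \<in> sets \<nu>"
      unfolding U'_def top[symmetric] sets
      by (intro openin_borel_of openin_continuous_map_preimage[OF _ U])
    show "measure \<nu> (U' i) = measure \<nu> U"
      unfolding U'_def by (rule right[OF fG[OF that] openin_borel_of[OF U]])
  qed
  \<comment> \<open>Left invariance replaces \<open>K\<close> by its translate \<open>?K\<close>,
    which is cut along the pieces. If a piece contains some \<open>z\<close> with
    \<open>y \<otimes> z\<close> in \<open>K\<close>, then \<open>inv (f i) \<otimes> z\<close> lies
    in \<open>V\<close>, and cancelling it on the right puts \<open>y \<otimes> f i\<close> in
    \<open>U\<close>. Hence the indicator is 1 whenever the piece contributes.\<close>
  have step: "measure \<mu> K \<le> (\<Sum>i<m. measure \<mu> (P i) * indicator (U' i) y)" if y: "y \<in> carrier G" for y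
  proof -
    let ?K = "{x \<in> carrier G. y \<otimes> x \<in> K}"
    have "continuous_map T T (\<lambda>x. y \<otimes> x)"
      using y top by (intro continuous_map_mult[OF G]) auto
    from measurable_sets[OF measurable_borel_of[OF this] K'] have Ks: "?K \<in> sets \<mu>"
      unfolding sets by (simp add: vimage_def Int_def top conj_commute)
    have "measure \<mu> K = measure \<mu> ?K" using left[OF y K'] by simp
    also have "?K = (\<Union>i<m. ?K \<inter> P i)" using UP by blast
    also have "measure \<mu> \<dots> \<le> (\<Sum>i<m. measure \<mu> (?K \<inter> P i))"
      using Ks Psets by (intro \<mu>.finite_measure_subadditive_finite) auto
    also have "\<dots> \<le> (\<Sum>i<m. measure \<mu> (P i) * indicator (U' i) y)"
    proof (rule sum_mono)
      fix i assume "i \<in> {..<m}"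
      then have i: "i < m" by simp
      show "measure \<mu> (?K \<inter> P i) \<le> measure \<mu> (P i) * indicator (U' i) y"
      proof (cases "?K \<inter> P i = {}")
        case False
        then obtain z where z: "z \<in> carrier G" "y \<otimes> z \<in> K" "z \<in> P i" by blast
        then have "inv (f i) \<otimes> z \<in> V" using PA[of i] i unfolding A_def nb_def by auto
        then have "y \<otimes> z \<otimes> inv (inv (f i) \<otimes> z) \<in> U" using KV z by fastforce
        moreover have "y \<otimes> z \<otimes> inv (inv (f i) \<otimes> z) = y \<otimes> f i"
          using y z fG[OF i] by (simp add: inv_mult_group m_assoc flip: m_assoc[of z "inv z"])
        ultimately have "y \<in> U' i" using y unfolding U'_def by simp
        then show ?thesis using Psets by (auto intro!: \<mu>.finite_measure_mono)
      qed simp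
    qed
    finally show ?thesis .
  qed
  have int: "integrable \<nu> (\<lambda>y. measure \<mu> (P i) * indicator (U' i) y)" if "i \<in> {..<m}" for i
    using U' that by (simp add: \<nu>.emeasure_eq_measure)
  have "measure \<mu> K = (\<integral>y. measure \<mu> K \<partial>\<nu>)" by (simp add: \<nu>.prob_space)
  also have "\<dots> \<le> (\<integral>y. (\<Sum>i<m. measure \<mu> (P i) * indicator (U' i) y) \<partial>\<nu>)"
  proof (rule integral_mono)
    show "measure \<mu> K \<le> (\<Sum>i<m. measure \<mu> (P i) * indicator (U' i) y)" if "y \<in> space \<nu>" for y
      using step that space top by blast
  qed (intro Bochner_Integration.integrable_sum int | simp)+
  also have "\<dots> = (\<Sum>i<m. \<integral>y. measure \<mu> (P i) * indicator (U' i) y \<partial>\<nu>)"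
    by (rule Bochner_Integration.integral_sum) (rule int)
  also have "\<dots> = (\<Sum>i<m. measure \<mu> (P i) * measure \<nu> (U' i))"
    using U' by (intro sum.cong) (auto simp: sets.sets_into_space Int_absorb2)
  \<comment> \<open>By right invariance the mass of \<open>U' i\<close> does not depend on
    \<open>i\<close>, so it factors out; the remaining weights belong to disjoint sets and sum to at
    most 1.\<close>
  also have "\<dots> = (\<Sum>i<m. measure \<mu> (P i)) * measure \<nu> U"
    using U' by (simp add: sum_distrib_right)
  also have "(\<Sum>i<m. measure \<mu> (P i)) = measure \<mu> (\<Union>i<m. P i)"
    using Psets disjP by (intro \<mu>.finite_measure_finite_Union[symmetric]) (auto simp: disjoint_family_on_def)
  also have "\<dots> * measure \<nu> U \<le> 1 * measure \<nu> U"
    by (intro mult_right_mono) auto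
  finally show "measure \<mu> K \<le> measure \<nu> U" by simp
qed

text \<open>Haar invariance is formulated with images under translations, whereas measurability and
  image measures work with preimages; this passes from one to the other.\<close>

lemma (in group) left_translate_eq_preimage:
  assumes "g \<in> carrier G" "A \<subseteq> carrier G"
  shows "(\<lambda>x. g \<otimes> x) ` A = {x \<in> carrier G. inv g \<otimes> x \<in> A}"
proof (intro equalityI subsetI)
  fix x assume "x \<in> {x \<in> carrier G. inv g \<otimes> x \<in> A}"
  then show "x \<in> (\<lambda>x. g \<otimes> x) ` A"
    using assms(1) by (intro image_eqI[of _ _ "inv g \<otimes> x"]) (simp_all flip: m_assoc)
next
  fix x assume "x \<in> (\<lambda>x. g \<otimes> x) ` A"
  then obtain a where "a \<in> A" "x = g \<otimes> a" "a \<in> carrier G" using assms(2) by blast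
  then show "x \<in> {x \<in> carrier G. inv g \<otimes> x \<in> A}"
    using assms(1) by (simp flip: m_assoc)
qed

lemma haar_measure_radon: "haar_measure G T \<mu> \<Longrightarrow> radon_prob T \<mu>"
  unfolding haar_measure_def by simp

lemma haar_measure_preimage:
  fixes G (structure)
  assumes G: "compact_group G T" and \<mu>: "haar_measure G T \<mu>"
    and g: "g \<in> carrier G" and A: "A \<in> sets (borel_of T)"
  shows "measure \<mu> {x \<in> carrier G. g \<otimes> x \<in> A} = measure \<mu> A"
proof -
  interpret group G by (rule compact_group_group[OF G])
  have "A \<subseteq> carrier G"
    using sets.sets_into_space[OF A] topspace_compact_group[OF G] by simp
  then have "{x \<in> carrier G. g \<otimes> x \<in> A} = (\<lambda>x. inv g \<otimes> x) ` A"
    using g left_translate_eq_preimage[of "inv g" A] by simp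
  then show ?thesis
    using \<mu> g A sets_radon[OF haar_measure_radon[OF \<mu>]] unfolding haar_measure_def by simp
qed

text \<open>Inversion turns the left invariant \<open>\<mu>\<close> into a right invariant
  \<open>\<nu>\<close>, and every left invariant Radon probability measure equals
  \<open>\<nu>\<close>. Both \<open>\<mu>\<close> and \<open>\<mu>'\<close> are compared with this
  one measure.\<close>

lemma haar_measure_unique:
  fixes G (structure)
  assumes G: "compact_group G T" and \<mu>: "haar_measure G T \<mu>" and \<mu>': "haar_measure G T \<mu>'"
  shows "\<mu> = \<mu>'"
proof -
  interpret group G by (rule compact_group_group[OF G])
  have top: "topspace T = carrier G" by (rule topspace_compact_group[OF G])
  note r = haar_measure_radon[OF \<mu>] haar_measure_radon[OF \<mu>']
  define \<nu> where "\<nu> = distr \<mu> (borel_of T) (\<lambda>x. inv x)"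
  have \<nu>: "radon_prob T \<nu>"
    unfolding \<nu>_def by (rule radon_distr[OF r(1) compact_group_inv[OF G] Hausdorff_compact_group[OF G]])
  have inv: "(\<lambda>x. inv x) \<in> measurable \<mu> (borel_of T)"
    using measurable_borel_of[OF compact_group_inv[OF G]] measurable_cong_sets[OF sets_radon[OF r(1)] refl]
    by blast
  have right: "measure \<nu> {x \<in> carrier G. x \<otimes> g \<in> A} = measure \<nu> A"
    if g: "g \<in> carrier G" and A: "A \<in> sets (borel_of T)" for g A
  proof -
    have "continuous_map T T (\<lambda>x. x \<otimes> g)"
      using g top by (intro continuous_map_mult[OF G]) auto
    from measurable_sets[OF measurable_borel_of[OF this] A]
    have Ag: "{x \<in> carrier G. x \<otimes> g \<in> A} \<in> sets (borel_of T)"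
      by (simp add: vimage_def Int_def top conj_commute)
    have "measure \<nu> {x \<in> carrier G. x \<otimes> g \<in> A} = measure \<mu> {x \<in> carrier G. inv x \<otimes> g \<in> A}"
      unfolding \<nu>_def measure_distr[OF inv Ag] space_radon[OF r(1)] top
      by (auto intro!: arg_cong[where f = "measure \<mu>"])
    \<comment> \<open>Since \<open>inv x \<otimes> g = inv (inv g \<otimes> x)\<close>, right
      translation by \<open>g\<close> becomes left translation by \<open>inv g\<close> before
      inversion.\<close>
    also have "{x \<in> carrier G. inv x \<otimes> g \<in> A} = {x \<in> carrier G. inv g \<otimes> x \<in> (\<lambda>x. inv x) -` A \<inter> space \<mu>}"
      using g unfolding space_radon[OF r(1)] top by (auto simp: inv_mult_group)
    also have "measure \<mu> \<dots> = measure \<mu> ((\<lambda>x. inv x) -` A \<inter> space \<mu>)"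
      using measurable_sets[OF inv A] sets_radon[OF r(1)] g
      by (intro haar_measure_preimage[OF G \<mu>]) auto
    also have "\<dots> = measure \<nu> A"
      unfolding \<nu>_def by (rule measure_distr[OF inv A, symmetric])
    finally show ?thesis .
  qed
  have "\<mu> = \<nu>"
    by (rule left_invariant_eq_right_invariant[OF G r(1) \<nu> haar_measure_preimage[OF G \<mu>] right])
  moreover have "\<mu>' = \<nu>"
    by (rule left_invariant_eq_right_invariant[OF G r(2) \<nu> haar_measure_preimage[OF G \<mu>'] right])
  ultimately show ?thesis by simp
qed

text \<open>Surjectivity lifts \<open>q\<close> to some \<open>g\<close> with
  \<open>\<phi> g = q\<close>; the preimage of a translate by \<open>q\<close> is then the translate
  by \<open>g\<close> of the preimage, and invariance of \<open>\<mu>\<close> applies.\<close>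

lemma haar_measure_distr:
  assumes G: "compact_group G T" and Q: "compact_group Q S" and \<mu>: "haar_measure G T \<mu>"
    and hom: "\<phi> \<in> hom G Q" and surj: "\<phi> ` carrier G = carrier Q" and cont: "continuous_map T S \<phi>"
  shows "haar_measure Q S (distr \<mu> (borel_of S) \<phi>)"
  unfolding haar_measure_def
proof (intro conjI ballI)
  interpret G: group G by (rule compact_group_group[OF G])
  interpret Q: group Q by (rule compact_group_group[OF Q])
  interpret group_hom G Q \<phi> using hom by unfold_locales
  note top = topspace_compact_group[OF G] topspace_compact_group[OF Q]
  note r = haar_measure_radon[OF \<mu>]
  have \<phi>: "\<phi> \<in> measurable \<mu> (borel_of S)"
    using measurable_borel_of[OF cont] measurable_cong_sets[OF sets_radon[OF r] refl] by blast
  show "radon_prob S (distr \<mu> (borel_of S) \<phi>)"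
    by (rule radon_distr[OF r cont Hausdorff_compact_group[OF Q]])
  fix q A assume q: "q \<in> carrier Q" and "A \<in> sets (distr \<mu> (borel_of S) \<phi>)"
  then have A: "A \<in> sets (borel_of S)" by simp
  have AQ: "A \<subseteq> carrier Q" using sets.sets_into_space[OF A] top by simp
  have qA: "(\<lambda>x. q \<otimes>\<^bsub>Q\<^esub> x) ` A = {x \<in> carrier Q. inv\<^bsub>Q\<^esub> q \<otimes>\<^bsub>Q\<^esub> x \<in> A}"
    using q AQ by (rule Q.left_translate_eq_preimage)
  have "continuous_map S S (\<lambda>x. inv\<^bsub>Q\<^esub> q \<otimes>\<^bsub>Q\<^esub> x)"
    using q top by (intro continuous_map_mult[OF Q]) auto
  from measurable_sets[OF measurable_borel_of[OF this] A]
  have qAs: "(\<lambda>x. q \<otimes>\<^bsub>Q\<^esub> x) ` A \<in> sets (borel_of S)"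
    unfolding qA by (simp add: vimage_def Int_def top conj_commute)
  obtain g where g: "g \<in> carrier G" "q = \<phi> g" using q surj by blast
  have "measure (distr \<mu> (borel_of S) \<phi>) ((\<lambda>x. q \<otimes>\<^bsub>Q\<^esub> x) ` A)
      = measure \<mu> {x \<in> carrier G. inv\<^bsub>G\<^esub> g \<otimes>\<^bsub>G\<^esub> x \<in> \<phi> -` A \<inter> space \<mu>}"
    unfolding measure_distr[OF \<phi> qAs] unfolding qA space_radon[OF r] top
    using g by (auto intro!: arg_cong[where f = "measure \<mu>"])
  also have "\<dots> = measure \<mu> (\<phi> -` A \<inter> space \<mu>)"
    using measurable_sets[OF \<phi> A] sets_radon[OF r] g
    by (intro haar_measure_preimage[OF G \<mu>]) auto
  also have "\<dots> = measure (distr \<mu> (borel_of S) \<phi>) A"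
    by (rule measure_distr[OF \<phi> A, symmetric])
  finally show "measure (distr \<mu> (borel_of S) \<phi>) ((\<lambda>x. q \<otimes>\<^bsub>Q\<^esub> x) ` A)
      = measure (distr \<mu> (borel_of S) \<phi>) A" .
qed

section \<open>Radon measures on products\<close>

text \<open>Open rectangles form a \<pi>-system, so the measures agree on the \<sigma>-algebra they
  generate. An open \<open>U\<close> need not belong to it, but any compact \<open>K\<close> inside
  \<open>U\<close> is covered by finitely many rectangles inside \<open>U\<close>, and their union
  does.\<close>

lemma radon_prod_eqI:
  fixes S :: "'i \<Rightarrow> 'a topology" and I :: "'i set" and T :: "'b topology"
  defines "Z \<equiv> prod_topology (product_topology S I) T"
  assumes \<nu>: "radon_prob Z \<nu>" and \<nu>': "radon_prob Z \<nu>'" and Haus: "Hausdorff_space Z" and I: "finite I"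
    and eq: "\<And>A B. (\<And>i. i \<in> I \<Longrightarrow> openin (S i) (A i)) \<Longrightarrow> openin T B \<Longrightarrow>
      measure \<nu> (PiE I A \<times> B) = measure \<nu>' (PiE I A \<times> B)"
  shows "\<nu> = \<nu>'"
proof (rule radon_eqI[OF \<nu> \<nu>' Haus])
  interpret \<nu>: prob_space \<nu> by (rule radon_prob_space[OF \<nu>])
  interpret \<nu>': prob_space \<nu>' by (rule radon_prob_space[OF \<nu>'])
  define \<R> where "\<R> = {PiE I A \<times> B | A B. (\<forall>i\<in>I. openin (S i) (A i)) \<and> openin T B}"
  have open\<R>: "openin Z R" if "R \<in> \<R>" for R
    using that I unfolding \<R>_def Z_def by (auto simp: openin_prod_Times_iff openin_PiE_gen)
  then have sub: "\<R> \<subseteq> Pow (topspace Z)" using openin_subset by blast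
  have stable: "Int_stable \<R>"
  proof (rule Int_stableI)
    fix R R' assume "R \<in> \<R>" "R' \<in> \<R>"
    then obtain A B A' B' where "R = PiE I A \<times> B" "R' = PiE I A' \<times> B'"
      "\<forall>i\<in>I. openin (S i) (A i)" "openin T B" "\<forall>i\<in>I. openin (S i) (A' i)" "openin T B'"
      unfolding \<R>_def by blast
    then have "R \<inter> R' = PiE I (\<lambda>i. A i \<inter> A' i) \<times> (B \<inter> B')"
      "\<forall>i\<in>I. openin (S i) (A i \<inter> A' i)" "openin T (B \<inter> B')"
      by (auto simp: PiE_Int Times_Int_Times)
    then show "R \<inter> R' \<in> \<R>" unfolding \<R>_def by blast
  qed
  have top\<R>: "topspace Z \<in> \<R>"
    unfolding \<R>_def Z_def by (auto intro!: exI[of _ "\<lambda>i. topspace (S i)"] exI[of _ "topspace T"])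
  let ?\<Sigma> = "sigma (topspace Z) \<R>"
  \<comment> \<open>The image under the identity is the restriction to the smaller \<sigma>-algebra,
    which is where uniqueness from a generator applies.\<close>
  have id: "(\<lambda>x. x) \<in> measurable M ?\<Sigma>" if "radon_prob Z M" for M
    using open\<R> sub that
    by (intro measurable_measure_of) (auto simp: space_radon sets_radon intro!: sets.Int openin_borel_of)
  have "distr \<nu> ?\<Sigma> (\<lambda>x. x) = distr \<nu>' ?\<Sigma> (\<lambda>x. x)"
  proof (rule measure_eqI_generator_eq[OF stable sub, where A = "\<lambda>_. topspace Z"])
    fix R assume R: "R \<in> \<R>"
    then have "R \<in> sets ?\<Sigma>" "R \<in> sets \<nu>" "R \<in> sets \<nu>'"
      using sub open\<R> \<nu> \<nu>' by (auto simp: sets_radon openin_borel_of)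
    moreover have "measure \<nu> R = measure \<nu>' R" using R eq unfolding \<R>_def by auto
    ultimately show "emeasure (distr \<nu> ?\<Sigma> (\<lambda>x. x)) R = emeasure (distr \<nu>' ?\<Sigma> (\<lambda>x. x)) R"
      by (simp add: emeasure_distr id \<nu> \<nu>' sets.sets_into_space Int_absorb2 vimage_def
          \<nu>.emeasure_eq_measure \<nu>'.emeasure_eq_measure)
  next
    show "emeasure (distr \<nu> ?\<Sigma> (\<lambda>x. x)) (topspace Z) \<noteq> \<infinity>" for i :: nat
      using finite_measure.emeasure_finite[OF prob_space.finite_measure[OF \<nu>.prob_space_distr[OF id[OF \<nu>]]]]
      by simp
  qed (use sub top\<R> in \<open>auto simp: sets_measure_of\<close>)
  then have agree: "measure \<nu> R = measure \<nu>' R" if "R \<in> sets ?\<Sigma>" for R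
    using measure_distr[OF id[OF \<nu>] that] measure_distr[OF id[OF \<nu>'] that] sets.sets_into_space[OF that]
      space_radon[OF \<nu>] space_radon[OF \<nu>'] space_measure_of[OF sub]
    by (simp add: vimage_def Int_absorb2)
  fix K U assume K: "compactin Z K" and U: "openin Z U" and KU: "K \<subseteq> U"
  have "\<forall>z\<in>K. \<exists>R. R \<in> \<R> \<and> z \<in> R \<and> R \<subseteq> U"
  proof
    fix z assume "z \<in> K"
    obtain x y where z: "z = (x, y)" by fastforce
    then have "(x, y) \<in> U" using KU \<open>z \<in> K\<close> by blast
    from U[unfolded Z_def openin_prod_topology_alt, rule_format, OF this]
    obtain V B where V: "openin (product_topology S I) V" "x \<in> V"
      and B: "openin T B" "y \<in> B" "V \<times> B \<subseteq> U"
      by blast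
    from V(1)[unfolded openin_product_topology_alt, rule_format, OF V(2)]
    obtain A where "\<forall>i\<in>I. openin (S i) (A i)" "x \<in> PiE I A" "PiE I A \<subseteq> V"
      by blast
    then have "PiE I A \<times> B \<in> \<R>" "z \<in> PiE I A \<times> B" "PiE I A \<times> B \<subseteq> U"
      using B z unfolding \<R>_def by auto
    then show "\<exists>R. R \<in> \<R> \<and> z \<in> R \<and> R \<subseteq> U" by (intro exI conjI)
  qed
  from bchoice[OF this] obtain R where R: "\<forall>z\<in>K. R z \<in> \<R> \<and> z \<in> R z \<and> R z \<subseteq> U" ..
  then obtain \<F> where \<F>: "finite \<F>" "\<F> \<subseteq> R ` K" "K \<subseteq> \<Union>\<F>"
  proof -
    have "\<And>V. V \<in> R ` K \<Longrightarrow> openin Z V" "K \<subseteq> \<Union>(R ` K)" using R open\<R> by blast+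
    from compactinD[OF K this] show thesis using that by blast
  qed
  then have sub\<F>: "\<F> \<subseteq> \<R>" and W: "\<Union>\<F> \<subseteq> U" using R by auto
  then have W\<Sigma>: "\<Union>\<F> \<in> sets ?\<Sigma>"
    using \<F> sub by (intro sets.finite_Union) auto
  have WZ: "openin Z (\<Union>\<F>)" using sub\<F> open\<R> by blast
  have "measure \<nu> K \<le> measure \<nu> (\<Union>\<F>)"
    using \<F> WZ \<nu> by (intro \<nu>.finite_measure_mono) (auto simp: sets_radon openin_borel_of)
  also have "\<dots> = measure \<nu>' (\<Union>\<F>)" by (rule agree[OF W\<Sigma>])
  also have "\<dots> \<le> measure \<nu>' U"
    using W U \<nu>' by (intro \<nu>'.finite_measure_mono) (auto simp: sets_radon openin_borel_of)
  finally show "measure \<nu> K \<le> measure \<nu>' U" .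
qed

section \<open>Commutators\<close>

lemma (in group) comm_closed:
  "x \<in> carrier G \<Longrightarrow> y \<in> carrier G \<Longrightarrow> comm G x y \<in> carrier G"
  unfolding comm_def by simp

lemma (in group) lcomm_closed:
  "(\<And>i. i < k \<Longrightarrow> h i \<in> carrier G) \<Longrightarrow> lcomm G h k \<in> carrier G"
  by (induction k rule: induct_nat_012) (simp_all add: comm_closed)

lemma (in group_hom) hom_comm:
  "x \<in> carrier G \<Longrightarrow> y \<in> carrier G \<Longrightarrow> comm H (h x) (h y) = h (comm G x y)"
  unfolding comm_def by simp

text \<open>The image tuple is a separate \<open>f'\<close>, tied to \<open>f\<close> only below
  \<open>k\<close>: points of a product space are extensional, so the tuple met later is a
  restriction of the composite.\<close>

lemma (in group_hom) hom_lcomm: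
  assumes "\<And>i. i < k \<Longrightarrow> f i \<in> carrier G" and "\<And>i. i < k \<Longrightarrow> f' i = h (f i)"
  shows "lcomm H f' k = h (lcomm G f k)"
  using assms
proof (induction k rule: induct_nat_012)
  case (ge2 k)
  then have "lcomm H f' (Suc k) = h (lcomm G f (Suc k))" by simp
  moreover have "lcomm G f (Suc k) \<in> carrier G" using ge2.prems by (intro G.lcomm_closed) simp
  ultimately show ?case using ge2.prems by (simp add: hom_comm)
qed simp_all

lemma lcomm_in_lower_iter:
  assumes "k \<ge> 1" and "\<And>i. i < k \<Longrightarrow> h i \<in> H"
  shows "lcomm G h k \<in> lower_iter G H k"
  using assms
proof (induction k rule: induct_nat_012)
  case (ge2 k)
  then have "lcomm G h (Suc k) \<in> lower_iter G H (Suc k)" "h (Suc k) \<in> H" by simp_all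
  then show ?case by (auto simp: comm_subgroup_def intro!: generate.incl)
qed simp_all

lemma comm_lcomm_in_nHG:
  assumes "n \<ge> 1" and "\<And>i. i < n \<Longrightarrow> h i \<in> H" and "g \<in> carrier G"
  shows "comm G (lcomm G h n) g \<in> nHG G n H"
  using lcomm_in_lower_iter[of n h H G] assms
  unfolding nHG_def comm_subgroup_def by (auto intro!: generate.incl)

section \<open>Product measures under quotient maps\<close>

lemma haar_prodE:
  assumes "haar_prod L TL K TK n \<nu>"
  obtains \<mu>K \<mu>L where "haar_measure K TK \<mu>K" "haar_measure L TL \<mu>L"
    "radon_prob (prod_topology (product_topology (\<lambda>_. TK) {..<n}) TL) \<nu>"
    "\<And>A B. (\<And>i. i < n \<Longrightarrow> A i \<in> sets \<mu>K) \<Longrightarrow> B \<in> sets \<mu>L \<Longrightarrow>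
      measure \<nu> (PiE {..<n} A \<times> B) = (\<Prod>i<n. measure \<mu>K (A i)) * measure \<mu>L B"
  using assms unfolding haar_prod_def by blast

text \<open>Preimages of rectangles under \<open>q\<close> are rectangles, so there the image
  measure splits into the images of the factors. \<open>restrict\<close> brings the image tuple back
  among the extensional functions.\<close>

lemma haar_prod_distr:
  assumes K: "compact_group K TK" and L: "compact_group L TL"
    and K': "compact_group K' TK'" and L': "compact_group L' TL'"
    and \<nu>: "haar_prod L TL K TK n \<nu>" and \<nu>': "haar_prod L' TL' K' TK' n \<nu>'"
    and \<phi>: "\<phi> \<in> hom K K'" "\<phi> ` carrier K = carrier K'" "continuous_map TK TK' \<phi>"
    and \<psi>: "\<psi> \<in> hom L L'" "\<psi> ` carrier L = carrier L'" "continuous_map TL TL' \<psi>"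
  defines "Z \<equiv> prod_topology (product_topology (\<lambda>_. TK) {..<n}) TL"
    and "Z' \<equiv> prod_topology (product_topology (\<lambda>_. TK') {..<n}) TL'"
    and "q \<equiv> \<lambda>z. (restrict (\<lambda>i. \<phi> (fst z i)) {..<n}, \<psi> (snd z))"
  shows "continuous_map Z Z' q" and "distr \<nu> (borel_of Z') q = \<nu>'"
proof -
  obtain \<mu>K \<mu>L where \<mu>: "haar_measure K TK \<mu>K" "haar_measure L TL \<mu>L"
    and r: "radon_prob Z \<nu>"
    and rect: "\<And>A B. (\<And>i. i < n \<Longrightarrow> A i \<in> sets \<mu>K) \<Longrightarrow> B \<in> sets \<mu>L \<Longrightarrow>
      measure \<nu> (PiE {..<n} A \<times> B) = (\<Prod>i<n. measure \<mu>K (A i)) * measure \<mu>L B"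
    using haar_prodE[OF \<nu>] unfolding Z_def by blast
  obtain \<mu>K' \<mu>L' where \<mu>': "haar_measure K' TK' \<mu>K'" "haar_measure L' TL' \<mu>L'"
    and r': "radon_prob Z' \<nu>'"
    and rect': "\<And>A B. (\<And>i. i < n \<Longrightarrow> A i \<in> sets \<mu>K') \<Longrightarrow> B \<in> sets \<mu>L' \<Longrightarrow>
      measure \<nu>' (PiE {..<n} A \<times> B) = (\<Prod>i<n. measure \<mu>K' (A i)) * measure \<mu>L' B"
    using haar_prodE[OF \<nu>'] unfolding Z'_def by blast
  note rK = haar_measure_radon[OF \<mu>(1)] and rL = haar_measure_radon[OF \<mu>(2)]
  note rK' = haar_measure_radon[OF \<mu>'(1)] and rL' = haar_measure_radon[OF \<mu>'(2)]
  note top = topspace_compact_group[OF K] topspace_compact_group[OF L]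
  \<comment> \<open>\<open>\<mu>K'\<close> and \<open>\<mu>L'\<close> are merely witnesses taken
    from \<open>haar_prod\<close>; uniqueness is what links them to the measures upstairs.\<close>
  have dK: "\<mu>K' = distr \<mu>K (borel_of TK') \<phi>"
    by (rule haar_measure_unique[OF K' \<mu>'(1) haar_measure_distr[OF K K' \<mu>(1) \<phi>]])
  have dL: "\<mu>L' = distr \<mu>L (borel_of TL') \<psi>"
    by (rule haar_measure_unique[OF L' \<mu>'(2) haar_measure_distr[OF L L' \<mu>(2) \<psi>]])
  have "continuous_map Z TK' (\<lambda>z. \<phi> (fst z i))" if "i < n" for i
  proof -
    have "continuous_map Z TK ((\<lambda>h. h i) \<circ> fst)"
      unfolding Z_def using that
      by (intro continuous_map_compose[OF continuous_map_fst] continuous_map_product_projection) simp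
    from continuous_map_compose[OF this \<phi>(3)] show ?thesis by (simp add: o_def)
  qed
  then have "continuous_map Z (product_topology (\<lambda>_. TK') {..<n}) (\<lambda>z. restrict (\<lambda>i. \<phi> (fst z i)) {..<n})"
    unfolding continuous_map_componentwise by auto
  moreover have "continuous_map Z TL' (\<lambda>z. \<psi> (snd z))"
    unfolding Z_def using continuous_map_compose[OF continuous_map_snd \<psi>(3)] by (simp add: o_def)
  ultimately show cont: "continuous_map Z Z' q"
    unfolding Z'_def q_def by (rule continuous_map_pairedI)
  have Haus: "Hausdorff_space Z'"
    unfolding Z'_def using Hausdorff_compact_group[OF K'] Hausdorff_compact_group[OF L']
    by (simp add: Hausdorff_space_prod_topology Hausdorff_space_product_topology)
  have q: "q \<in> measurable \<nu> (borel_of Z')"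
    using measurable_borel_of[OF cont] measurable_cong_sets[OF sets_radon[OF r] refl] by blast
  have \<phi>m: "\<phi> \<in> measurable \<mu>K (borel_of TK')"
    using measurable_borel_of[OF \<phi>(3)] measurable_cong_sets[OF sets_radon[OF rK] refl] by blast
  have \<psi>m: "\<psi> \<in> measurable \<mu>L (borel_of TL')"
    using measurable_borel_of[OF \<psi>(3)] measurable_cong_sets[OF sets_radon[OF rL] refl] by blast
  show "distr \<nu> (borel_of Z') q = \<nu>'"
  proof (rule radon_prod_eqI[where S = "\<lambda>_. TK'" and I = "{..<n}" and T = TL', folded Z'_def,
        OF radon_distr[OF r cont Haus] r' Haus finite_lessThan])
    fix A B assume A: "\<And>i. i \<in> {..<n} \<Longrightarrow> openin TK' (A i)" and B: "openin TL' B"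
    have A': "A i \<in> sets (borel_of TK')" if "i < n" for i
      using A that by (simp add: openin_borel_of)
    have B': "B \<in> sets (borel_of TL')" using B by (rule openin_borel_of)
    have "openin Z' (PiE {..<n} A \<times> B)"
      unfolding Z'_def using A B by (simp add: openin_prod_Times_iff openin_PiE_gen)
    then have AB: "PiE {..<n} A \<times> B \<in> sets (borel_of Z')" by (rule openin_borel_of)
    have pre: "q -` (PiE {..<n} A \<times> B) \<inter> space \<nu>
        = PiE {..<n} (\<lambda>i. \<phi> -` A i \<inter> space \<mu>K) \<times> (\<psi> -` B \<inter> space \<mu>L)" (is "?l = ?r")
    proof (rule Set.set_eqI)
      fix z
      show "z \<in> ?l \<longleftrightarrow> z \<in> ?r"
        unfolding space_radon[OF r] space_radon[OF rK] space_radon[OF rL] Z_def q_def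
        by (cases z) (auto simp: PiE_iff)
    qed
    have "measure (distr \<nu> (borel_of Z') q) (PiE {..<n} A \<times> B)
        = (\<Prod>i<n. measure \<mu>K (\<phi> -` A i \<inter> space \<mu>K)) * measure \<mu>L (\<psi> -` B \<inter> space \<mu>L)"
      unfolding measure_distr[OF q AB] pre
      using measurable_sets[OF \<phi>m A'] measurable_sets[OF \<psi>m B'] by (rule rect)
    also have "\<dots> = (\<Prod>i<n. measure \<mu>K' (A i)) * measure \<mu>L' B"
      unfolding dK dL measure_distr[OF \<psi>m B'] using measure_distr[OF \<phi>m A'] by simp
    also have "\<dots> = measure \<nu>' (PiE {..<n} A \<times> B)"
      using A' B' sets_radon[OF rK'] sets_radon[OF rL'] by (intro rect'[symmetric]) auto
    finally show "measure (distr \<nu> (borel_of Z') q) (PiE {..<n} A \<times> B) = measure \<nu>' (PiE {..<n} A \<times> B)" .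
  qed
qed

theorem theorem3p5:
  fixes G :: "('a, 'b) monoid_scheme" and T :: "'a topology"
    and H N :: "'a set" and n :: nat
    and \<nu>1 :: "((nat \<Rightarrow> 'a) \<times> 'a) measure"
    and \<nu>2 :: "((nat \<Rightarrow> 'a set) \<times> 'a set) measure"
  assumes "compact_group G T"
    and "n \<ge> 1"
    and "subgroup H G" and "closedin T H"
    and "normal N G" and "closedin T N"
    and "N \<subseteq> H"
    and "haar_prod G T (G\<lparr>carrier := H\<rparr>) (subtopology T H) n \<nu>1"
    and "haar_prod (G Mod N) (quot_top T (rcosets\<^bsub>G\<^esub> N))
           ((G\<lparr>carrier := H\<rparr>) Mod N) (quot_top (subtopology T H) (rcosets\<^bsub>G\<lparr>carrier := H\<rparr>\<^esub> N)) n \<nu>2"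
  shows "dn G n \<nu>1 \<le> dn (G Mod N) n \<nu>2
         \<and> (N \<inter> nHG G n H = {\<one>\<^bsub>G\<^esub>} \<longrightarrow> dn G n \<nu>1 = dn (G Mod N) n \<nu>2)"
proof -
  note G = assms(1) and H = assms(3) and N = assms(5)
  interpret normal N G by (rule N)
  let ?H = "G\<lparr>carrier := H\<rparr>" and ?TH = "subtopology T H"
  let ?QH = "quot_top ?TH (rcosets\<^bsub>?H\<^esub> N)" and ?QG = "quot_top T (rcosets\<^bsub>G\<^esub> N)"
  let ?\<phi> = "\<lambda>x. N #>\<^bsub>G\<^esub> x"
  \<comment> \<open>A coset depends only on the multiplication, which \<open>?H\<close> shares with
    \<open>G\<close>, so one function serves as both quotient maps, with targets \<open>?QH\<close>
    and \<open>?QG\<close>.\<close>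
  have coset: "(\<lambda>x. N #>\<^bsub>?H\<^esub> x) = ?\<phi>" by (simp add: r_coset_def)
  have top: "topspace T = carrier G" by (rule topspace_compact_group[OF G])
  have HG: "H \<subseteq> carrier G" by (rule subgroup.subset[OF H])
  have cH: "compact_group ?H ?TH" using G H assms(4) by (rule compact_group_subgroup)
  have NH: "N \<lhd> ?H" using H N assms(7) by (rule normal_restrict_supergroup)
  have clN: "closedin ?TH N" using assms(6,7) by (simp add: closedin_closed_subtopology assms(4) closedin_subset_topspace)
  have cQH: "compact_group (?H Mod N) ?QH" using cH NH clN by (rule compact_group_Mod)
  have cQG: "compact_group (G Mod N) ?QG" using G N assms(6) by (rule compact_group_Mod)
  have \<psi>: "?\<phi> \<in> hom G (G Mod N)" "?\<phi> ` carrier G = carrier (G Mod N)" "continuous_map T ?QG ?\<phi>"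
    using r_coset_hom_Mod quotient_imp_continuous_map[OF quotient_map_cosets[OF G N]]
    by (auto simp: carrier_FactGroup)
  have \<phi>: "?\<phi> \<in> hom ?H (?H Mod N)" "?\<phi> ` carrier ?H = carrier (?H Mod N)" "continuous_map ?TH ?QH ?\<phi>"
    using normal.r_coset_hom_Mod[OF NH] quotient_imp_continuous_map[OF quotient_map_cosets[OF cH NH]]
    by (auto simp: carrier_FactGroup coset)
  define Z where "Z = prod_topology (product_topology (\<lambda>_. ?TH) {..<n}) T"
  define Z' where "Z' = prod_topology (product_topology (\<lambda>_. ?QH) {..<n}) ?QG"
  define q where "q = (\<lambda>z. (restrict (\<lambda>i. ?\<phi> (fst z i)) {..<n}, ?\<phi> (snd z)))"
  note d = haar_prod_distr[OF cH G cQH cQG assms(8,9) \<phi> \<psi>, folded q_def Z_def Z'_def]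
  obtain r: "radon_prob Z \<nu>1" and r': "radon_prob Z' \<nu>2"
    using haar_prodE[OF assms(8)] haar_prodE[OF assms(9)] unfolding Z_def Z'_def by metis
  interpret prob_space \<nu>1 by (rule radon_prob_space[OF r])
  interpret \<phi>: group_hom G "G Mod N" ?\<phi>
    by (intro group_hom.intro group_hom_axioms.intro compact_group_group[OF G] factorgroup_is_group \<psi>(1))
  let ?c = "\<lambda>z. comm G (lcomm G (fst z) n) (snd z)"
  define S where "S = {(h, g) \<in> space \<nu>1. comm G (lcomm G h n) g = \<one>\<^bsub>G\<^esub>}"
  define S' where "S' = {(h, g) \<in> space \<nu>2. comm (G Mod N) (lcomm (G Mod N) h n) g = \<one>\<^bsub>G Mod N\<^esub>}"
  define P where "P = {z \<in> topspace Z. ?c z \<in> N}"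
  have zH: "fst z i \<in> H" if "z \<in> topspace Z" "i < n" for z i
    using that top unfolding Z_def by (auto simp: PiE_iff)
  have zG: "snd z \<in> carrier G" if "z \<in> topspace Z" for z
    using that top unfolding Z_def by auto
  have cG: "?c z \<in> carrier G" if "z \<in> topspace Z" for z
    using zH[OF that] zG[OF that] HG by (intro comm_closed lcomm_closed) auto
  \<comment> \<open>Coset representatives are chosen coordinate by coordinate. Surjectivity later
    identifies \<open>S'\<close> with the direct image of \<open>P\<close> under
    \<open>q\<close>.\<close>
  have surj: "q ` topspace Z = topspace Z'"
  proof
    show "q ` topspace Z \<subseteq> topspace Z'" using d(1) continuous_map_image_subset_topspace by blast
    show "topspace Z' \<subseteq> q ` topspace Z"
    proof
      fix w assume w: "w \<in> topspace Z'"
      have tQ: "topspace ?QH = ?\<phi> ` H" "topspace ?QG = ?\<phi> ` carrier G"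
        using \<phi>(2) \<psi>(2) topspace_compact_group[OF cQH] topspace_compact_group[OF cQG] by simp_all
      have ext: "fst w \<in> extensional {..<n}"
        using w unfolding Z'_def by (auto simp: PiE_iff)
      have "\<forall>i\<in>{..<n}. \<exists>x. x \<in> H \<and> fst w i = ?\<phi> x"
      proof
        fix i assume "i \<in> {..<n}"
        then have "fst w i \<in> ?\<phi> ` H"
          using w unfolding Z'_def tQ(1)[symmetric] by (auto simp: PiE_iff)
        then show "\<exists>x. x \<in> H \<and> fst w i = ?\<phi> x" by blast
      qed
      from bchoice[OF this] obtain f where f: "\<forall>i\<in>{..<n}. f i \<in> H \<and> fst w i = ?\<phi> (f i)" ..
      obtain g where g: "g \<in> carrier G" "snd w = ?\<phi> g"
        using w tQ unfolding Z'_def by auto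
      have "(restrict f {..<n}, g) \<in> topspace Z"
        using f g HG top unfolding Z_def by (auto simp: PiE_iff)
      moreover have "q (restrict f {..<n}, g) = w"
      proof (rule prod_eqI)
        \<comment> \<open>Outside \<open>{..<n}\<close> both sides are \<open>undefined\<close>, one
          by \<open>restrict\<close> and the other by extensionality of
          \<open>fst w\<close>.\<close>
        show "fst (q (restrict f {..<n}, g)) = fst w"
          unfolding q_def using f ext by (auto simp: extensional_def fun_eq_iff)
      qed (simp add: q_def g)
      ultimately show "w \<in> q ` topspace Z" by (metis imageI)
    qed
  qed
  have cq: "comm (G Mod N) (lcomm (G Mod N) (fst (q z)) n) (snd (q z)) = ?\<phi> (?c z)"
    if z: "z \<in> topspace Z" for z
  proof -
    have "lcomm (G Mod N) (fst (q z)) n = ?\<phi> (lcomm G (fst z) n)"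
      using zH[OF z] HG by (intro \<phi>.hom_lcomm) (auto simp: q_def)
    moreover have "lcomm G (fst z) n \<in> carrier G"
      using zH[OF z] HG by (intro lcomm_closed) auto
    ultimately show ?thesis
      using \<phi>.hom_comm zG[OF z] by (simp add: q_def)
  qed
  have mem: "q z \<in> S' \<longleftrightarrow> z \<in> P" if z: "z \<in> topspace Z" for z
  proof -
    have "q z \<in> topspace Z'" using surj z by blast
    \<comment> \<open>The identity of \<open>G Mod N\<close> is the coset \<open>N\<close> itself,
      so a commutator that is trivial in the quotient is one that lies in \<open>N\<close>.\<close>
    moreover have "?\<phi> (?c z) = N \<longleftrightarrow> ?c z \<in> N"
      using coset_join1[OF _ cG[OF z] is_subgroup] coset_join2[OF cG[OF z] is_subgroup] by blast
    ultimately show ?thesis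
      using z cq[OF z] unfolding S'_def P_def space_radon[OF r'] by (simp add: case_prod_unfold)
  qed
  have PZ: "P \<subseteq> topspace Z" unfolding P_def by blast
  have pre: "q -` S' \<inter> space \<nu>1 = P"
    using mem PZ unfolding space_radon[OF r] by blast
  have compZ: "compact_space Z"
    unfolding Z_def
    using compact_space_compact_group[OF cH] compact_space_compact_group[OF G]
    by (simp add: compact_space_prod_topology compact_space_product_topology)
  have HausZ': "Hausdorff_space Z'"
    unfolding Z'_def using Hausdorff_compact_group[OF cQH] Hausdorff_compact_group[OF cQG]
    by (simp add: Hausdorff_space_prod_topology Hausdorff_space_product_topology)
  have "continuous_map Z T (\<lambda>z. fst z i)" if "i < n" for i
  proof -
    have "continuous_map Z ?TH ((\<lambda>h. h i) \<circ> fst)"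
      unfolding Z_def using that
      by (intro continuous_map_compose[OF continuous_map_fst] continuous_map_product_projection) simp
    then show ?thesis by (simp add: o_def continuous_map_in_subtopology)
  qed
  then have "continuous_map Z T ?c"
    by (intro continuous_map_comm[OF G] continuous_map_lcomm[OF G]) (simp_all add: Z_def continuous_map_snd)
  then have closedP: "closedin Z P"
    unfolding P_def using assms(6) by (rule closedin_continuous_map_preimage)
  \<comment> \<open>Measurability of \<open>S'\<close> comes from compactness of \<open>P\<close>; this avoids comparing the quotient
    topology of \<open>H/N\<close> with the subspace topology inherited from \<open>G/N\<close>.\<close>
  have "S' \<subseteq> q ` topspace Z" unfolding surj S'_def space_radon[OF r'] by auto
  then have "S' = q ` P" using mem PZ by blast
  moreover have "compactin Z' (q ` P)"
    using closedin_compact_space[OF compZ closedP] d(1) by (rule image_compactin)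
  ultimately have "closedin Z' S'" using compactin_imp_closedin[OF HausZ'] by simp
  then have S': "S' \<in> sets (borel_of Z')" by (rule closedin_borel_of)
  have q: "q \<in> measurable \<nu>1 (borel_of Z')"
    using measurable_borel_of[OF d(1)] measurable_cong_sets[OF sets_radon[OF r] refl] by blast
  have dn': "dn (G Mod N) n \<nu>2 = measure \<nu>1 P"
    unfolding dn_def S'_def[symmetric] using measure_distr[OF q S', unfolded d(2) pre] .
  have dn: "dn G n \<nu>1 = measure \<nu>1 S" unfolding dn_def S_def ..
  have SP: "S \<subseteq> P" unfolding S_def P_def space_radon[OF r] by auto
  have "P \<in> sets \<nu>1" unfolding sets_radon[OF r] by (rule closedin_borel_of[OF closedP])
  then have "measure \<nu>1 S \<le> measure \<nu>1 P" using SP by (intro finite_measure_mono)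
  moreover have "S = P" if triv: "N \<inter> nHG G n H = {\<one>\<^bsub>G\<^esub>}"
  proof -
    have "z \<in> S" if z: "z \<in> P" for z
    proof -
      have "?c z \<in> nHG G n H"
        using zH zG z assms(2) unfolding P_def by (intro comm_lcomm_in_nHG) auto
      then have "?c z = \<one>\<^bsub>G\<^esub>" using triv z unfolding P_def by blast
      then show ?thesis using z unfolding S_def P_def space_radon[OF r] by auto
    qed
    with SP show ?thesis by blast
  qed
  ultimately show ?thesis unfolding dn dn' by auto
qed

end
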